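(* Let $p \geq 5$ be a prime. For $u \in \mathbb{F}_p$ let $K_u = \sum_{x=1}^{p-1} e_p(x + u x^{-1})$, where $e_p(t) = \exp(2\pi i t/p)$ and $x^{-1}$ is the inverse of $x$ modulo $p$, and let $V_6(p) = \sum_{u=1}^{p-1} K_u^6$. For $k \in \{2,3,\ldots,p-1\}$ with $k \not\equiv 9 \pmod p$, let $E_k$ be the elliptic curve over $\mathbb{F}_p$ given by $$y^2 = 4k x^3 + (k^2 - 6k - 3)x^2 + 4x,$$ and let $a_p(E_k) = p + 1 - |E_k(\mathbb{F}_p)|$ be its Frobenius trace, where $|E_k(\mathbb{F}_p)|$ counts the points including the point at infinity. Then $$V_6(p) = 4p^4 - 8p^3 + \left[4\left(\frac{p}{3}\right) + 2\right]p^2 - 5p - 1 + p^2 \sum_{\substack{k=2\\ k \not\equiv 9 \ (\mathrm{mod}\ p)}}^{p-1} \big(a_p(E_k) + 1\big)^2.$$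
   Context: $\left(\frac{\cdot}{\cdot}\right)$ denotes the Legendre symbol; $\left(\frac{p}{3}\right)$ is the Legendre symbol of $p$ modulo $3$. The values $k \equiv 1, 9 \pmod p$ are excluded because they give singular curves. *)

theory Defs
  imports "HOL-Analysis.Analysis" "HOL-Number_Theory.Number_Theory"
begin

text \<open>
  The field with \<open>p\<close> elements is represented by the residues \<open>{0..<p}\<close>,
  with equality of its elements expressed as congruence modulo \<open>p\<close>.
\<close>

definition e_char :: "int \<Rightarrow> int \<Rightarrow> complex" where
  "e_char p t = exp (2 * of_real pi * \<i> * of_int t / of_int p)"

definition kloosterman :: "int \<Rightarrow> int \<Rightarrow> complex" where
  "kloosterman p u = (\<Sum>x\<in>{1..p-1}. e_char p (x + u * modular_inverse p x))"

definition V6 :: "int \<Rightarrow> complex" where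
  "V6 p = (\<Sum>u\<in>{1..p-1}. kloosterman p u ^ 6)"

text \<open>The point at infinity is \<open>None\<close>; \<open>Some (x, y)\<close> is an affine point.\<close>

definition E_points :: "int \<Rightarrow> int \<Rightarrow> (int \<times> int) option set" where
  "E_points p k = insert None (Some ` {(x, y). x \<in> {0..<p} \<and> y \<in> {0..<p} \<and>
     [y^2 = 4 * k * x^3 + (k^2 - 6 * k - 3) * x^2 + 4 * x] (mod p)})"

definition frobenius_trace :: "int \<Rightarrow> int \<Rightarrow> int" where
  "frobenius_trace p k = p + 1 - int (card (E_points p k))"

text \<open>
  For the parameters \<open>k\<close> in question the model above is nonsingular, hence an elliptic curve
  with a single point at infinity: its right-hand side is a cubic modulo \<open>p\<close> whose discriminant
  \<open>b\<^sup>2 * 4\<^sup>2 - 4 * (4 * k) * 4\<^sup>3\<close>, where \<open>b = k\<^sup>2 - 6 * k - 3\<close>, is a unit modulo \<open>p\<close>.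
\<close>

lemma E_nonsingular:
  fixes p k :: int
  assumes "prime p" "p \<ge> 5" "k \<in> {2..p-1}" "\<not> [k = 9] (mod p)"
  shows "\<not> p dvd 4 * k"
    and "\<not> p dvd (k^2 - 6 * k - 3)^2 * 4^2 - 4 * (4 * k) * 4^3"
proof -
  have two: "\<not> p dvd 2" and k: "\<not> p dvd k" and k1: "\<not> p dvd k - 1"
    using assms(2,3) zdvd_not_zless[of _ p] by (auto dest: zdvd_imp_le)
  have k9: "\<not> p dvd k - 9"
    using assms(4) by (simp add: cong_iff_dvd_diff)
  have "\<not> p dvd 2 ^ 2 * k"
    using two k assms(1) by (auto simp only: prime_dvd_mult_iff dest: prime_dvd_power)
  then show "\<not> p dvd 4 * k" by simp
  have "(k^2 - 6 * k - 3)^2 * 4^2 - 4 * (4 * k) * 4^3 = 2 ^ 4 * ((k - 1)^3 * (k - 9))"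
    by (simp add: power2_eq_square power3_eq_cube algebra_simps)
  then show "\<not> p dvd (k^2 - 6 * k - 3)^2 * 4^2 - 4 * (4 * k) * 4^3"
    using two k1 k9 assms(1) by (auto simp only: prime_dvd_mult_iff dest: prime_dvd_power)
qed

end

theory Submission
  imports Defs
begin

text \<open>
  Scaling the variables by the third one turns \<open>K\<^sub>u\<^sup>3\<close> into the sum of
  \<open>e\<^sub>p (z \<sigma> + u \<tau> / z)\<close> over units \<open>a, b, z\<close>, where \<open>\<sigma> = a + b + 1\<close> and \<open>\<tau> = 1/a + 1/b + 1\<close>.
  Orthogonality in \<open>u\<close> and then in \<open>z\<close> expresses the sixth moment through
  \<open>\<Sum>\<^sub>k (h k)\<^sup>2\<close>, where \<open>h k\<close> counts the pairs \<open>(a, b)\<close> with \<open>\<tau> \<noteq> 0\<close> and \<open>\<sigma> \<tau> = k\<close>.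
  Fixing \<open>s = a + b\<close> determines the product \<open>a b\<close>, so \<open>h k\<close> is a character sum of a quartic in \<open>s\<close>,
  which a projective substitution turns into the cubic defining \<open>E\<^sub>k\<close>: for \<open>k \<noteq> 0, 1\<close> one gets
  \<open>h k = p - 5 - a\<^sub>p(E\<^sub>k)\<close>.  The exceptional values \<open>h 0\<close>, \<open>h 1\<close>, \<open>h 9\<close> and the total
  \<open>\<Sum>\<^sub>k h k = p\<^sup>2 - 3 p + 3\<close> are computed directly, the symbol \<open>(p/3)\<close> entering as \<open>(-3/p)\<close>.
\<close>

locale prime_modulus =
  fixes p :: int
  assumes prime_p: "prime p" and p_ge_5: "p \<ge> 5"
begin

section \<open>Arithmetic of residues modulo \<open>p\<close>: inverses and reindexing of
  sums\<close>

abbreviation "iv \<equiv> modular_inverse p"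

text \<open>Elements of F_p are represented by integers, so a function on F_p becomes a function
  constant on residue classes. Such functions can be evaluated at unreduced arguments when sums are
  reindexed.\<close>

definition periodic :: "(int \<Rightarrow> 'a) \<Rightarrow> bool" where
  "periodic f \<longleftrightarrow> (\<forall>x y. [x = y] (mod p) \<longrightarrow> f x = f y)"

lemma periodicI: "(\<And>x y. [x = y] (mod p) \<Longrightarrow> f x = f y) \<Longrightarrow> periodic f"
  by (auto simp: periodic_def)

lemma periodicD: "periodic f \<Longrightarrow> [x = y] (mod p) \<Longrightarrow> f x = f y"
  by (auto simp: periodic_def)

lemma periodic_mod: "periodic f \<Longrightarrow> f (x mod p) = f x"
  by (rule periodicD) auto

lemma cong_dvd_cong: "[x = y] (mod p) \<Longrightarrow> p dvd x \<longleftrightarrow> p dvd y"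
  by (rule cong_dvd_iff)

lemmas cong_rules = cong_add cong_diff cong_minus_minus_iff[THEN iffD2] cong_mult cong_pow cong_refl

lemma dvd_mult_iff: "p dvd a * b \<longleftrightarrow> p dvd a \<or> p dvd b"
  using prime_p by (simp add: prime_dvd_mult_iff)

lemma dvd_power2_iff: "p dvd a\<^sup>2 \<longleftrightarrow> p dvd a"
  by (simp add: power2_eq_square dvd_mult_iff)

lemma not_dvd_small: "0 < a \<Longrightarrow> a < p \<Longrightarrow> \<not> p dvd a"
  using zdvd_not_zless by blast

lemma not_dvd_unit: "a \<in> {1..p-1} \<Longrightarrow> \<not> p dvd a"
  using not_dvd_small[of a] by auto

lemma not_dvd_numerals [simp]: "\<not> p dvd 1" "\<not> p dvd 2" "\<not> p dvd 3" "\<not> p dvd 4"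
  using not_dvd_small[of 1] not_dvd_small[of 2] not_dvd_small[of 3] not_dvd_small[of 4] p_ge_5
  by simp_all

lemma abs_p_neq_1 [simp]: "\<bar>p\<bar> \<noteq> 1"
  using p_ge_5 by simp

lemma coprime_iff: "coprime x p \<longleftrightarrow> \<not> p dvd x"
  using prime_imp_coprime[OF prime_p, of x] coprime_common_divisor[of x p p] prime_p
  by (auto simp: coprime_commute dest: not_prime_unit)

lemma dvd_mult_iv: "\<not> p dvd x \<Longrightarrow> p dvd x * iv x - 1"
  using cong_modular_inverse1[of x p] by (simp add: coprime_iff cong_iff_dvd_diff)

lemma dvd_iv_iff: "p dvd iv x \<longleftrightarrow> p dvd x"
proof (cases "p dvd x")
  case True
  then show ?thesis by (simp add: coprime_iff)
next
  case False
  then show ?thesis using coprime_modular_inverse[of x p] by (simp add: coprime_iff)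
qed

text \<open>Congruent arguments give equal values, not merely congruent ones:
  \<open>modular_inverse\<close> returns the representative in \<open>{0..<p}\<close>, and 0 on
  multiples of \<open>p\<close>.\<close>

lemma iv_cong: assumes "[x = y] (mod p)" shows "iv x = iv y"
proof (cases "p dvd x")
  case True
  then show ?thesis using cong_dvd_cong[OF assms] by (simp add: coprime_iff)
next
  case False
  then have "\<not> p dvd y" using cong_dvd_cong[OF assms] by simp
  have "[x * iv y = y * iv y] (mod p)" by (intro cong_rules assms)
  also have "[y * iv y = 1] (mod p)"
    using \<open>\<not> p dvd y\<close> by (simp add: cong_modular_inverse1 coprime_iff)
  finally show ?thesis
    using p_ge_5 by (intro modular_inverse_int_eqI)
      (auto simp: modular_inverse_int_nonneg modular_inverse_int_less)
qed

lemma iv_mult: "[iv (x * y) = iv x * iv y] (mod p)"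
proof (cases "p dvd x \<or> p dvd y")
  case True
  then have "\<not> coprime (x * y) p" "\<not> coprime x p \<or> \<not> coprime y p"
    unfolding coprime_iff by (auto simp: dvd_mult_iff)
  then show ?thesis by auto
next
  case False
  then show ?thesis
    using p_ge_5 modular_inverse_int_mult[of x p y] by (simp add: coprime_iff mult.commute)
qed

lemma iv_unit: "x \<in> {1..p-1} \<Longrightarrow> iv x \<in> {1..p-1}"
  using mult_modular_inverse_int_pos[of p x] modular_inverse_int_less[of p x] p_ge_5
  using not_dvd_unit[of x] by (auto simp: coprime_iff)

lemma iv_iv: assumes "x \<in> {1..p-1}" shows "iv (iv x) = x"
proof (rule modular_inverse_int_eqI)
  show "[iv x * x = 1] (mod p)"
    using not_dvd_unit[OF assms] by (simp add: cong_modular_inverse2 coprime_iff)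
qed (use assms in auto)

lemma residues_split: "{0..<p} = insert 0 {1..p-1}"
  using p_ge_5 by auto

lemma sum_residues_split: "(\<Sum>x\<in>{0..<p}. f x) = f 0 + (\<Sum>x\<in>{1..p-1}. f x)"
  for f :: "int \<Rightarrow> 'a::comm_monoid_add"
  unfolding residues_split by simp

lemma sum_units: "(\<Sum>x\<in>{1..p-1}. f x) = (\<Sum>x\<in>{0..<p}. f x) - f 0"
  for f :: "int \<Rightarrow> 'a::ab_group_add"
  unfolding residues_split by simp

text \<open>Reduced modulo \<open>p\<close>, the affine map is an injective self-map of a finite
  set, hence a permutation of the residues; periodicity of \<open>f\<close> then removes the
  reduction.\<close>

lemma sum_affine:
  fixes f :: "int \<Rightarrow> 'a::comm_monoid_add"
  assumes "\<not> p dvd a" and f: "periodic f"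
  shows "(\<Sum>x\<in>{0..<p}. f (a * x + c)) = (\<Sum>x\<in>{0..<p}. f x)"
proof -
  have inj: "inj_on (\<lambda>x. (a * x + c) mod p) {0..<p}"
  proof (rule inj_onI)
    fix x y assume xy: "x \<in> {0..<p}" "y \<in> {0..<p}" and "(a * x + c) mod p = (a * y + c) mod p"
    then have "p dvd (a * x + c) - (a * y + c)" by (simp add: mod_eq_dvd_iff)
    then have "p dvd a * (x - y)" by (simp add: algebra_simps)
    then have "p dvd x - y" using assms(1) by (simp add: dvd_mult_iff)
    then have "x mod p = y mod p" by (simp add: mod_eq_dvd_iff)
    then show "x = y" using xy by simp
  qed
  moreover have "(\<lambda>x. (a * x + c) mod p) ` {0..<p} = {0..<p}"
    using inj p_ge_5 by (intro endo_inj_surj) auto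
  ultimately have "bij_betw (\<lambda>x. (a * x + c) mod p) {0..<p} {0..<p}"
    by (simp add: bij_betw_def)
  then have "(\<Sum>x\<in>{0..<p}. f ((a * x + c) mod p)) = (\<Sum>x\<in>{0..<p}. f x)"
    by (rule sum.reindex_bij_betw)
  then show ?thesis by (simp add: periodic_mod[OF f])
qed

lemma sum_units_mult:
  fixes f :: "int \<Rightarrow> 'a::ab_group_add"
  assumes "\<not> p dvd a" "periodic f"
  shows "(\<Sum>x\<in>{1..p-1}. f (a * x)) = (\<Sum>x\<in>{1..p-1}. f x)"
  using sum_affine[OF assms, of 0] by (simp add: sum_units)

lemma sum_units_iv:
  fixes f :: "int \<Rightarrow> 'a::comm_monoid_add"
  shows "(\<Sum>x\<in>{1..p-1}. f (iv x)) = (\<Sum>x\<in>{1..p-1}. f x)"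
  by (rule sum.reindex_bij_witness[where i = iv and j = iv]) (auto simp: iv_iv iv_unit simp del: atLeastAtMost_iff)

lemma sum_residues_single:
  fixes f :: "int \<Rightarrow> 'a::semiring_1"
  assumes "periodic f"
  shows "(\<Sum>x\<in>{0..<p}. of_bool (p dvd x - b) * f x) = f b"
proof -
  have "(\<Sum>x\<in>{0..<p}. of_bool (p dvd x - b) * f x) = (\<Sum>x\<in>{0..<p}. if x = b mod p then f x else 0)"
  proof (rule sum.cong)
    fix x assume "x \<in> {0..<p}"
    then have "p dvd x - b \<longleftrightarrow> x = b mod p"
      using mod_eq_dvd_iff[of x p b] by simp
    then show "of_bool (p dvd x - b) * f x = (if x = b mod p then f x else 0)" by simp
  qed simp
  also have "\<dots> = f b" using p_ge_5 by (simp add: periodic_mod[OF assms])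
  finally show ?thesis .
qed

lemma count_residue: "(\<Sum>x\<in>{0..<p}. of_bool (p dvd x - b)) = (1 :: 'a :: semiring_1)"
  using sum_residues_single[of "\<lambda>_. 1 :: 'a" b] by (simp add: periodic_def)

lemma count_residue_minus: "(\<Sum>x\<in>{0..<p}. of_bool (p dvd b - x)) = (1 :: 'a :: semiring_1)"
  using count_residue[of b] by (simp add: dvd_diff_commute)

subsection \<open>Quadratic characters\<close>

lemma Legendre_cong: assumes "[a = b] (mod p)" shows "Legendre a p = Legendre b p"
proof -
  have "[c = a] (mod p) \<longleftrightarrow> [c = b] (mod p)" "[a = c] (mod p) \<longleftrightarrow> [b = c] (mod p)" for c
    using assms by (auto simp: cong_def)
  then show ?thesis by (simp add: Legendre_def QuadRes_def)
qed

lemma periodic_Legendre: "(\<And>x y. [x = y] (mod p) \<Longrightarrow> [f x = f y] (mod p)) \<Longrightarrow>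
    periodic (\<lambda>x. Legendre (f x) p)"
  by (intro periodicI Legendre_cong)

lemma Legendre_dvd: "p dvd a \<Longrightarrow> Legendre a p = 0"
  by (simp add: Legendre_def cong_0_iff)

lemma Legendre_square: "\<not> p dvd a \<Longrightarrow> Legendre (a\<^sup>2) p = 1"
  by (auto simp: Legendre_def cong_0_iff dvd_power2_iff QuadRes_def intro: exI[of _ a])

text \<open>This is the bridge from counting solutions to Legendre symbols. If a = b^2 is nonzero,
  then y^2 - a = (y - b)(y + b), and the two roots differ because \<open>p\<close> is odd.\<close>

lemma count_sqrt: "(\<Sum>y\<in>{0..<p}. of_bool (p dvd y\<^sup>2 - a)) = 1 + Legendre a p"
proof (cases "p dvd a")
  case True
  then have "p dvd y\<^sup>2 - a \<longleftrightarrow> p dvd y - 0" for y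
    by (simp add: dvd_diff_left_iff dvd_power2_iff)
  then show ?thesis using True count_residue[of 0] by (simp only: Legendre_dvd add_0_right)
next
  case a: False
  show ?thesis
  proof (cases "QuadRes p a")
    case True
    then obtain b where "[b\<^sup>2 = a] (mod p)" by (auto simp: QuadRes_def)
    then have b: "p dvd b\<^sup>2 - a" by (simp add: cong_iff_dvd_diff)
    have nb: "\<not> p dvd b"
    proof
      assume "p dvd b"
      then have "p dvd b\<^sup>2 - (b\<^sup>2 - a)" using b by (metis dvd_diff dvd_power2_iff)
      also have "b\<^sup>2 - (b\<^sup>2 - a) = a" by simp
      finally show False using a by simp
    qed
    have "of_bool (p dvd y\<^sup>2 - a) = (of_bool (p dvd y - b) + of_bool (p dvd y - (- b)) :: int)" for y
    proof -
      have "p dvd y\<^sup>2 - a \<longleftrightarrow> p dvd (y\<^sup>2 - a) - (b\<^sup>2 - a)" using b by (metis dvd_diff dvd_add diff_add_cancel)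
      also have "(y\<^sup>2 - a) - (b\<^sup>2 - a) = (y - b) * (y - (- b))" by (simp add: algebra_simps power2_eq_square)
      finally have 1: "p dvd y\<^sup>2 - a \<longleftrightarrow> p dvd y - b \<or> p dvd y - (- b)" by (simp only: dvd_mult_iff)
      have 2: "\<not> (p dvd y - b \<and> p dvd y - (- b))"
      proof
        assume "p dvd y - b \<and> p dvd y - (- b)"
        then have "p dvd (y - (- b)) - (y - b)" by (metis dvd_diff)
        then have "p dvd 2 * b" by simp
        with nb show False by (simp only: dvd_mult_iff not_dvd_numerals) simp
      qed
      show ?thesis using 1 2 by auto
    qed
    then have "(\<Sum>y\<in>{0..<p}. of_bool (p dvd y\<^sup>2 - a)) = (2::int)"
      by (simp only: sum.distrib count_residue)
    then show ?thesis using True a by (simp add: Legendre_def cong_0_iff)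
  next
    case False
    then have "\<not> p dvd y\<^sup>2 - a" for y by (auto simp: QuadRes_def cong_iff_dvd_diff)
    then show ?thesis using False a by (simp add: Legendre_def cong_0_iff)
  qed
qed

lemma periodic_of_bool: "(\<And>x y. [x = y] (mod p) \<Longrightarrow> [f x = f y] (mod p)) \<Longrightarrow>
    periodic (\<lambda>x. of_bool (p dvd f x))"
  by (intro periodicI arg_cong[where f = of_bool] cong_dvd_cong)

text \<open>Multiplication by \<open>c\<close> carries the square roots of \<open>a\<close>
  bijectively to those of c^2 a, so \<open>count_sqrt\<close> gives both symbols the same
  value.\<close>

lemma Legendre_square_mult: assumes "\<not> p dvd c" shows "Legendre (c\<^sup>2 * a) p = Legendre a p"
proof -
  have "1 + Legendre (c\<^sup>2 * a) p = (\<Sum>y\<in>{0..<p}. of_bool (p dvd (c * y + 0)\<^sup>2 - c\<^sup>2 * a))"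
    unfolding count_sqrt[symmetric]
    by (rule sum_affine[symmetric, OF assms]) (intro periodic_of_bool cong_rules)
  moreover have "p dvd (c * y + 0)\<^sup>2 - c\<^sup>2 * a \<longleftrightarrow> p dvd y\<^sup>2 - a" for y
  proof -
    have "(c * y + 0)\<^sup>2 - c\<^sup>2 * a = c\<^sup>2 * (y\<^sup>2 - a)" by (simp add: algebra_simps power2_eq_square)
    then show ?thesis using assms by (simp only: dvd_mult_iff dvd_power2_iff) simp
  qed
  ultimately show ?thesis by (simp only: count_sqrt)
qed

text \<open>Double counting of the pairs (y, a) with y^2 = a: every \<open>y\<close> has exactly one
  square, so there are \<open>p\<close> of them.\<close>

lemma sum_Legendre: "(\<Sum>a\<in>{0..<p}. Legendre a p) = 0"
proof -
  have "(\<Sum>a\<in>{0..<p}. 1 + Legendre a p) = (\<Sum>y\<in>{0..<p}. \<Sum>a\<in>{0..<p}. of_bool (p dvd y\<^sup>2 - a))"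
    unfolding count_sqrt[symmetric] by (rule sum.swap)
  also have "\<dots> = (\<Sum>y\<in>{0..<p}. 1)" by (simp only: count_residue_minus)
  finally show ?thesis by (simp add: sum.distrib)
qed

text \<open>The solutions are the roots of X^2 - s X + t. Completing the square with 2a - s reduces
  the count to square roots of the discriminant.\<close>

lemma count_sum_product:
  "(\<Sum>a\<in>{0..<p}. of_bool (p dvd a * (s - a) - t)) = 1 + Legendre (s\<^sup>2 - 4 * t) p"
proof -
  have "1 + Legendre (s\<^sup>2 - 4 * t) p =
      (\<Sum>a\<in>{0..<p}. of_bool (p dvd (2 * a + (- s))\<^sup>2 - (s\<^sup>2 - 4 * t)))"
    unfolding count_sqrt[symmetric]
    by (rule sum_affine[symmetric]) (simp, intro periodic_of_bool cong_rules)
  moreover have "p dvd (2 * a + (- s))\<^sup>2 - (s\<^sup>2 - 4 * t) \<longleftrightarrow> p dvd a * (s - a) - t" for a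
  proof -
    have "(2 * a + (- s))\<^sup>2 - (s\<^sup>2 - 4 * t) = - 4 * (a * (s - a) - t)"
      by (simp add: algebra_simps power2_eq_square)
    then show ?thesis by (simp only: dvd_mult_iff) simp
  qed
  ultimately show ?thesis by simp
qed

text \<open>Reciprocity contributes the sign (-1)^m with m = (p - 1)/2, and Euler's criterion
  absorbs it into (-3)^m. This gives the equality first as a congruence modulo
  \<open>p\<close>.\<close>

lemma Legendre_neg_3: "Legendre (- 3) p = Legendre p 3"
proof -
  define m where "m = nat ((p - 1) div 2)"
  have p: "prime (nat p)" "int (nat p) = p" "2 < nat p"
    using prime_p p_ge_5 prime_int_nat_transfer[of p] by linarith+
  have m: "(nat p - 1) div 2 = m" unfolding m_def using p_ge_5 by (simp add: nat_div_distrib nat_diff_distrib)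
  have euler: "[Legendre a p = a ^ m] (mod p)" for a
    using euler_criterion[OF p(1) p(3), of a] p(2) m by simp
  have "Legendre p 3 * Legendre 3 p = (- 1) ^ m"
    using Quadratic_Reciprocity_int[of p 3] p prime_p p_ge_5 not_dvd_numerals by (auto simp: m_def)
  moreover have "Legendre 3 p * Legendre 3 p = 1"
    by (auto simp: Legendre_def cong_0_iff)
  ultimately have *: "Legendre p 3 = (- 1) ^ m * Legendre 3 p"
    by (metis mult.assoc mult.right_neutral)
  have "[(- 1) ^ m * Legendre 3 p = (- 1) ^ m * 3 ^ m] (mod p)"
    by (intro cong_rules euler)
  also have "(- 1) ^ m * 3 ^ m = (- 3 :: int) ^ m" by (simp flip: power_mult_distrib)
  also have "[(- 3) ^ m = Legendre (- 3) p] (mod p)" by (rule cong_sym[OF euler])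
  finally have "[Legendre (- 3) p = Legendre p 3] (mod p)" unfolding * by (rule cong_sym)
  then have "p dvd Legendre (- 3) p - Legendre p 3" by (simp add: cong_iff_dvd_diff)
  \<comment> \<open>Both symbols lie in {-1, 0, 1}, so they differ by at most 2, and the congruence
    is an equality.\<close>
  moreover have "\<bar>Legendre (- 3) p - Legendre p 3\<bar> < p"
    using p_ge_5 by (auto simp: Legendre_def)
  ultimately show ?thesis
    using dvd_imp_le_int[of "Legendre (- 3) p - Legendre p 3" p] by force
qed

subsection \<open>Counting pairs\<close>

definition \<sigma> :: "int \<Rightarrow> int \<Rightarrow> int" where "\<sigma> a b = a + b + 1"
definition \<tau> :: "int \<Rightarrow> int \<Rightarrow> int" where "\<tau> a b = iv a + iv b + 1"

definition h :: "int \<Rightarrow> int" where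
  "h k = (\<Sum>a\<in>{1..p-1}. \<Sum>b\<in>{1..p-1}. of_bool (\<not> p dvd \<tau> a b \<and> p dvd \<sigma> a b * \<tau> a b - k))"

definition cubic :: "int \<Rightarrow> int \<Rightarrow> int" where
  "cubic k x = 4 * k * x^3 + (k^2 - 6 * k - 3) * x^2 + 4 * x"

lemma cong_tau:
  assumes "a \<in> {1..p-1}" "b \<in> {1..p-1}"
  shows "[a * b * \<tau> a b = a * b + a + b] (mod p)"
proof -
  have "p dvd (a * iv a - 1) * b + (b * iv b - 1) * a"
    using assms[THEN not_dvd_unit, THEN dvd_mult_iv] by (meson dvd_add dvd_mult2)
  also have "(a * iv a - 1) * b + (b * iv b - 1) * a = a * b * \<tau> a b - (a * b + a + b)"
    by (simp add: \<tau>_def algebra_simps)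
  finally show ?thesis by (simp add: cong_iff_dvd_diff)
qed

lemma dvd_tau_iff:
  assumes "a \<in> {1..p-1}" "b \<in> {1..p-1}"
  shows "p dvd \<tau> a b \<longleftrightarrow> p dvd a * b + a + b"
  using assms[THEN not_dvd_unit] cong_dvd_cong[OF cong_tau[OF assms]]
  by (simp add: dvd_mult_iff)

text \<open>Multiplication by the unit \<open>a * b\<close> clears the denominators in
  \<open>\<tau> a b\<close>.\<close>

lemma dvd_sigma_tau_iff:
  assumes "a \<in> {1..p-1}" "b \<in> {1..p-1}"
  shows "p dvd \<sigma> a b * \<tau> a b - k \<longleftrightarrow> p dvd (a + b + 1) * (a * b + a + b) - k * (a * b)"
proof -
  have "p dvd \<sigma> a b * \<tau> a b - k \<longleftrightarrow> p dvd (a * b) * (\<sigma> a b * \<tau> a b - k)"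
    using assms[THEN not_dvd_unit] by (simp add: dvd_mult_iff)
  also have "(a * b) * (\<sigma> a b * \<tau> a b - k) = (a + b + 1) * (a * b * \<tau> a b) - k * (a * b)"
    by (simp add: \<sigma>_def algebra_simps)
  also have "p dvd \<dots> \<longleftrightarrow> p dvd (a + b + 1) * (a * b + a + b) - k * (a * b)"
    by (intro cong_dvd_cong cong_rules cong_tau assms)
  finally show ?thesis .
qed

text \<open>For nonzero \<open>k\<close> the condition on \<open>\<tau>\<close> is automatic: if
  \<open>\<tau> a b\<close> vanished, so would the product that equals \<open>k\<close>.\<close>

lemma h_eq_cubic_count:
  assumes "\<not> p dvd k"
  shows "h k = (\<Sum>a\<in>{1..p-1}. \<Sum>b\<in>{1..p-1}.
    of_bool (p dvd (a + b + 1) * (a * b + a + b) - k * (a * b)))"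
  unfolding h_def
proof (intro sum.cong refl arg_cong[where f = of_bool])
  fix a b assume ab: "a \<in> {1..p-1}" "b \<in> {1..p-1}"
  have "\<not> p dvd \<tau> a b" if "p dvd \<sigma> a b * \<tau> a b - k"
  proof
    assume "p dvd \<tau> a b"
    then have "p dvd \<sigma> a b * \<tau> a b - (\<sigma> a b * \<tau> a b - k)" using that by (metis dvd_diff dvd_mult)
    then show False using assms by simp
  qed
  then show "(\<not> p dvd \<tau> a b \<and> p dvd \<sigma> a b * \<tau> a b - k) \<longleftrightarrow>
      p dvd (a + b + 1) * (a * b + a + b) - k * (a * b)"
    using dvd_sigma_tau_iff[OF ab] by auto
qed

lemma sum_units_of_bool:
  "(\<Sum>x\<in>{1..p-1}. f x) = (\<Sum>x\<in>{0..<p}. of_bool (\<not> p dvd x) * f x)"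
  for f :: "int \<Rightarrow> 'a::semiring_1"
proof -
  have "(\<Sum>x\<in>{1..p-1}. of_bool (\<not> p dvd x) * f x) = (\<Sum>x\<in>{1..p-1}. f x)"
    by (intro sum.cong) (auto dest: not_dvd_unit simp del: atLeastAtMost_iff)
  then show ?thesis by (simp only: sum_residues_split) simp
qed

lemma count_unit: "\<not> p dvd c \<Longrightarrow> (\<Sum>x\<in>{1..p-1}. of_bool (p dvd x - c)) = (1::int)"
  unfolding sum_units by (simp only: count_residue) simp

lemma count_unit_plus: "\<not> p dvd c \<Longrightarrow> (\<Sum>x\<in>{1..p-1}. of_bool (p dvd x + c)) = (1::int)"
  using count_unit[of "- c"] by simp

text \<open>This is the substitution b = s - a. The restriction to units moves into an indicator
  because a shift permutes all residues but not the units.\<close>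

lemma sum_pairs_by_sum:
  fixes F :: "int \<Rightarrow> int \<Rightarrow> int"
  assumes F: "\<And>a. periodic (F a)"
  shows "(\<Sum>a\<in>{1..p-1}. \<Sum>b\<in>{1..p-1}. F a b) =
    (\<Sum>s\<in>{0..<p}. \<Sum>a\<in>{0..<p}. of_bool (\<not> p dvd a * (s - a)) * F a (s - a))"
proof -
  have inner: "(\<Sum>b\<in>{0..<p}. of_bool (\<not> p dvd b) * F a b) =
      (\<Sum>s\<in>{0..<p}. of_bool (\<not> p dvd 1 * s + (- a)) * F a (1 * s + (- a)))" for a
  proof -
    have "periodic (\<lambda>b. of_bool (\<not> p dvd b) * F a b)"
      by (rule periodicI) (simp only: cong_dvd_cong periodicD[OF F])
    then show ?thesis by (rule sum_affine[OF not_dvd_numerals(1), symmetric])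
  qed
  have "(\<Sum>a\<in>{1..p-1}. \<Sum>b\<in>{1..p-1}. F a b) =
      (\<Sum>a\<in>{0..<p}. of_bool (\<not> p dvd a) * (\<Sum>b\<in>{0..<p}. of_bool (\<not> p dvd b) * F a b))"
    by (simp only: sum_units_of_bool)
  also have "\<dots> = (\<Sum>a\<in>{0..<p}. of_bool (\<not> p dvd a) *
      (\<Sum>s\<in>{0..<p}. of_bool (\<not> p dvd 1 * s + (- a)) * F a (1 * s + (- a))))"
    by (simp only: inner)
  also have "\<dots> = (\<Sum>a\<in>{0..<p}. \<Sum>s\<in>{0..<p}. of_bool (\<not> p dvd a * (s - a)) * F a (s - a))"
    unfolding sum_distrib_left by (intro sum.cong refl) (simp add: dvd_mult_iff)
  finally show ?thesis by (subst sum.swap)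
qed

text \<open>For fixed \<open>a\<close> the only candidate is b = -a - 1, which is a unit unless a =
  -1.\<close>

lemma count_sigma: "(\<Sum>a\<in>{1..p-1}. \<Sum>b\<in>{1..p-1}. of_bool (p dvd a + b + 1)) = p - 2"
proof -
  have "(\<Sum>b\<in>{1..p-1}. of_bool (p dvd a + b + 1)) = 1 - (of_bool (p dvd a + 1) :: int)" for a
    unfolding sum_units using count_residue[of "- a - 1", where 'a = int] by (simp add: algebra_simps)
  then show ?thesis
    using p_ge_5 count_unit_plus[OF not_dvd_numerals(1)] by (simp only: sum_subtractf) simp
qed

lemma count_tau: "(\<Sum>a\<in>{1..p-1}. \<Sum>b\<in>{1..p-1}. of_bool (p dvd \<tau> a b)) = p - 2"
proof -
  have "(\<Sum>a\<in>{1..p-1}. \<Sum>b\<in>{1..p-1}. of_bool (p dvd \<tau> a b)) =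
      (\<Sum>a\<in>{1..p-1}. \<Sum>b\<in>{1..p-1}. of_bool (p dvd iv a + b + 1) :: int)"
    unfolding \<tau>_def by (intro sum.cong refl sum_units_iv)
  also have "\<dots> = (\<Sum>a\<in>{1..p-1}. \<Sum>b\<in>{1..p-1}. of_bool (p dvd a + b + 1))"
    by (rule sum_units_iv)
  finally show ?thesis by (simp only: count_sigma)
qed

text \<open>If both quantities vanish, then a + b = -1 and a b = 1. Thus \<open>a\<close> and
  \<open>b\<close> are the roots of X^2 + X + 1, whose discriminant is -3.\<close>

lemma count_sigma_tau:
  "(\<Sum>a\<in>{1..p-1}. \<Sum>b\<in>{1..p-1}. of_bool (p dvd \<sigma> a b \<and> p dvd \<tau> a b)) = 1 + Legendre p 3"
proof -
  define F :: "int \<Rightarrow> int \<Rightarrow> int"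
    where "F a b = of_bool (p dvd a + b + 1) * of_bool (p dvd a * b + a + b)" for a b
  have F: "periodic (F a)" for a
  proof (rule periodicI)
    fix x y assume xy: "[x = y] (mod p)"
    have "p dvd a + x + 1 \<longleftrightarrow> p dvd a + y + 1" "p dvd a * x + a + x \<longleftrightarrow> p dvd a * y + a + y"
      by (intro cong_dvd_cong cong_rules xy)+
    then show "F a x = F a y" by (simp add: F_def)
  qed
  have "(\<Sum>a\<in>{1..p-1}. \<Sum>b\<in>{1..p-1}. of_bool (p dvd \<sigma> a b \<and> p dvd \<tau> a b)) =
      (\<Sum>a\<in>{1..p-1}. \<Sum>b\<in>{1..p-1}. F a b)"
    unfolding F_def \<sigma>_def by (intro sum.cong refl) (simp only: dvd_tau_iff of_bool_conj)
  also have "\<dots> = (\<Sum>s\<in>{0..<p}. \<Sum>a\<in>{0..<p}. of_bool (\<not> p dvd a * (s - a)) * F a (s - a))"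
    by (rule sum_pairs_by_sum[OF F])
  also have "\<dots> = (\<Sum>s\<in>{0..<p}. \<Sum>a\<in>{0..<p}.
      of_bool (p dvd s - (- 1)) * of_bool (p dvd a * (s - a) - (- s)))"
  proof (intro sum.cong refl)
    fix s a
    \<comment> \<open>With s = -1 the second condition says that the product is 1, so
      \<open>a\<close> and s - a are automatically units.\<close>
    have "\<not> p dvd a * (s - a)" if "p dvd s - (- 1)" "p dvd a * (s - a) - (- s)"
    proof
      assume "p dvd a * (s - a)"
      then have "p dvd (s - (- 1)) - (a * (s - a) - (- s)) + a * (s - a)"
        using that by (metis dvd_diff dvd_add)
      then show False by simp
    qed
    then show "of_bool (\<not> p dvd a * (s - a)) * F a (s - a) =
        of_bool (p dvd s - (- 1)) * of_bool (p dvd a * (s - a) - (- s))"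
      by (auto simp: F_def algebra_simps)
  qed
  also have "\<dots> = (\<Sum>s\<in>{0..<p}. of_bool (p dvd s - (- 1)) * (1 + Legendre (s\<^sup>2 - 4 * (- s)) p))"
    by (simp only: sum_distrib_left[symmetric] count_sum_product)
  also have "\<dots> = 1 + Legendre ((- 1)\<^sup>2 - 4 * (- (- 1))) p"
    by (rule sum_residues_single)
      (intro periodicI arg_cong2[where f = "(+)"] refl Legendre_cong cong_rules)
  finally show ?thesis by (simp add: Legendre_neg_3)
qed

lemma count_tau_nonzero:
  "(\<Sum>a\<in>{1..p-1}. \<Sum>b\<in>{1..p-1}. of_bool (\<not> p dvd \<tau> a b)) = p\<^sup>2 - 3 * p + 3"
proof -
  have "(\<Sum>a\<in>{1..p-1}. \<Sum>b\<in>{1..p-1}. of_bool (\<not> p dvd \<tau> a b)) = (p - 1)\<^sup>2 - (p - 2)"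
    unfolding count_tau[symmetric]
    using p_ge_5 by (simp only: of_bool_not_iff sum_subtractf) (simp add: power2_eq_square)
  then show ?thesis by (simp add: power2_eq_square algebra_simps)
qed

lemma sum_h: "(\<Sum>k\<in>{0..<p}. h k) = p\<^sup>2 - 3 * p + 3"
proof -
  have "(\<Sum>k\<in>{0..<p}. h k) = (\<Sum>a\<in>{1..p-1}. \<Sum>k\<in>{0..<p}. \<Sum>b\<in>{1..p-1}.
      of_bool (\<not> p dvd \<tau> a b \<and> p dvd \<sigma> a b * \<tau> a b - k))"
    unfolding h_def by (rule sum.swap)
  also have "\<dots> = (\<Sum>a\<in>{1..p-1}. \<Sum>b\<in>{1..p-1}. \<Sum>k\<in>{0..<p}.
      of_bool (\<not> p dvd \<tau> a b) * of_bool (p dvd \<sigma> a b * \<tau> a b - k))"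
    unfolding of_bool_conj by (intro sum.cong refl sum.swap)
  also have "\<dots> = p\<^sup>2 - 3 * p + 3"
    by (simp only: sum_distrib_left[symmetric] count_residue_minus mult_1_right count_tau_nonzero)
  finally show ?thesis .
qed

text \<open>When k = 0, a nonzero \<open>\<tau>\<close> forces \<open>\<sigma>\<close> to vanish;
  pairs where both vanish must be taken off.\<close>

lemma h_0: "h 0 = p - 3 - Legendre p 3"
proof -
  have "h 0 = (\<Sum>a\<in>{1..p-1}. \<Sum>b\<in>{1..p-1}.
      of_bool (p dvd a + b + 1) - of_bool (p dvd \<sigma> a b \<and> p dvd \<tau> a b))"
    unfolding h_def by (intro sum.cong refl) (auto simp: dvd_mult_iff \<sigma>_def)
  then show ?thesis by (simp only: sum_subtractf count_sigma count_sigma_tau)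
qed

text \<open>For k = 1 the cubic splits as (a + b)(a + 1)(b + 1). Inclusion-exclusion over these
  three lines involves three pairwise intersections, (-1, 1), (1, -1) and (-1, -1), and no triple
  one since 1 and -1 differ modulo \<open>p\<close>.\<close>

lemma h_1: "h 1 = 3 * p - 6"
proof -
  have eq: "of_bool (p dvd (a + b + 1) * (a * b + a + b) - 1 * (a * b)) =
      of_bool (p dvd b - (- a)) + of_bool (p dvd a + 1) + of_bool (p dvd b + 1)
      - of_bool (p dvd a + 1) * of_bool (p dvd b - 1) - of_bool (p dvd a - 1) * of_bool (p dvd b + 1)
      - of_bool (p dvd a + 1) * (of_bool (p dvd b + 1) :: int)" for a b
  proof -
    have "(a + b + 1) * (a * b + a + b) - 1 * (a * b) = (a + b) * ((a + 1) * (b + 1))"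
      by (simp add: algebra_simps)
    then have 0: "p dvd (a + b + 1) * (a * b + a + b) - 1 * (a * b) \<longleftrightarrow>
        p dvd a + b \<or> p dvd a + 1 \<or> p dvd b + 1" by (simp only: dvd_mult_iff)
    have 1: "p dvd a + b \<longleftrightarrow> p dvd b - 1" if "p dvd a + 1"
      using that dvd_add_right_iff[of p "a + 1" "b - 1"] by (simp add: algebra_simps)
    have 2: "p dvd a + b \<longleftrightarrow> p dvd a - 1" if "p dvd b + 1"
      using that dvd_add_right_iff[of p "b + 1" "a - 1"] by (simp add: algebra_simps)
    have 3: "\<not> (p dvd c + 1 \<and> p dvd c - 1)" for c
    proof
      assume "p dvd c + 1 \<and> p dvd c - 1"
      then have "p dvd (c + 1) - (c - 1)" by (metis dvd_diff)
      then show False by simp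
    qed
    show ?thesis
      using 0 1 2 3[of a] 3[of b] by (cases "p dvd a + 1"; cases "p dvd b + 1") (auto simp: algebra_simps)
  qed
  have "(\<Sum>a\<in>{1..p-1}. \<Sum>b\<in>{1..p-1}. of_bool (p dvd b - (- a))) = (\<Sum>a\<in>{1..p-1}. 1::int)"
    by (intro sum.cong refl count_unit) (auto dest: not_dvd_unit simp del: atLeastAtMost_iff)
  moreover have "h 1 = (\<Sum>a\<in>{1..p-1}. \<Sum>b\<in>{1..p-1}.
      of_bool (p dvd (a + b + 1) * (a * b + a + b) - 1 * (a * b)))"
    by (rule h_eq_cubic_count) simp
  ultimately show ?thesis
    using p_ge_5
    by (simp only: eq sum.distrib sum_subtractf sum_distrib_left[symmetric] sum_distrib_right[symmetric]
        count_unit[OF not_dvd_numerals(1)] count_unit_plus[OF not_dvd_numerals(1)] sum_constant mult_1_right) simp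
qed

section \<open>From the pair counts \<open>h k\<close> to the curves E_k\<close>

lemma cubic_cong: "[x = y] (mod p) \<Longrightarrow> [cubic k x = cubic k y] (mod p)"
  unfolding cubic_def by (intro cong_rules)

lemma periodic_Legendre_cubic: "periodic (\<lambda>x. Legendre (cubic k x) p)"
  by (intro periodicI Legendre_cong cubic_cong)

text \<open>
  The substitution is \<open>m = s / (s + 1 - k) = 1 + (k - 1) w\<close> with \<open>w = 1 / (s + 1 - k)\<close> and \<open>d = 1 / w\<close>.
\<close>

lemma Legendre_quartic_eq_cubic:
  assumes k: "\<not> p dvd k - 1" and w: "\<not> p dvd w" and dw: "[d * w = 1] (mod p)"
  defines "s \<equiv> d + k - 1"
  shows "Legendre (s\<^sup>2 + 4 * (s * (s + 1) * w)) p = Legendre (cubic k ((k - 1) * w + 1)) p"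
proof -
  define m where "m = (k - 1) * w + 1"
  have "[d * w + (k - 1) * w = 1 + (k - 1) * w] (mod p)"
    by (intro cong_rules dw)
  then have sw: "[s * w = m] (mod p)" by (simp add: s_def m_def algebra_simps)
  \<comment> \<open>The square factor clears \<open>s\<close> in favour of m = s w; then (k - 1) w =
    m - 1 eliminates \<open>w\<close> and leaves a cubic in \<open>m\<close>.\<close>
  have "Legendre (s\<^sup>2 + 4 * (s * (s + 1) * w)) p =
      Legendre (((k - 1) * w)\<^sup>2 * (s\<^sup>2 + 4 * (s * (s + 1) * w))) p"
    using k w by (intro Legendre_square_mult[symmetric]) (simp add: dvd_mult_iff)
  also have "((k - 1) * w)\<^sup>2 * (s\<^sup>2 + 4 * (s * (s + 1) * w)) =
      (k - 1)\<^sup>2 * ((s * w)\<^sup>2 + 4 * ((s * w) * (s * w + w) * w))"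
    by (simp add: algebra_simps power2_eq_square)
  also have "Legendre \<dots> p = Legendre ((k - 1)\<^sup>2 * (m\<^sup>2 + 4 * (m * (m + w) * w))) p"
    by (intro Legendre_cong cong_rules sw)
  also have "(k - 1)\<^sup>2 * (m\<^sup>2 + 4 * (m * (m + w) * w)) = cubic k m"
    by (simp add: m_def cubic_def algebra_simps power2_eq_square power3_eq_cube)
  finally show ?thesis by (simp add: m_def)
qed

text \<open>In terms of s = a + b the equation is linear in the product a b, which is what makes the
  inner count a quadratic problem.\<close>

lemma h_eq_sum_by_sum:
  assumes "\<not> p dvd k"
  shows "h k = (\<Sum>s\<in>{0..<p}. \<Sum>a\<in>{0..<p}. of_bool (\<not> p dvd a * (s - a)) *
    of_bool (p dvd (s + 1 - k) * (a * (s - a)) + s * (s + 1)))"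
proof -
  define F :: "int \<Rightarrow> int \<Rightarrow> int"
    where "F a b = of_bool (p dvd (a + b + 1) * (a * b + a + b) - k * (a * b))" for a b
  have "h k = (\<Sum>a\<in>{1..p-1}. \<Sum>b\<in>{1..p-1}. F a b)"
    unfolding F_def by (rule h_eq_cubic_count[OF assms])
  also have "\<dots> = (\<Sum>s\<in>{0..<p}. \<Sum>a\<in>{0..<p}. of_bool (\<not> p dvd a * (s - a)) * F a (s - a))"
    unfolding F_def by (rule sum_pairs_by_sum) (intro periodic_of_bool cong_rules)
  also have "\<dots> = (\<Sum>s\<in>{0..<p}. \<Sum>a\<in>{0..<p}. of_bool (\<not> p dvd a * (s - a)) *
      of_bool (p dvd (s + 1 - k) * (a * (s - a)) + s * (s + 1)))"
  proof (intro sum.cong refl arg_cong2[where f = "(*)"])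
    fix s a
    have "(a + (s - a) + 1) * (a * (s - a) + a + (s - a)) - k * (a * (s - a)) =
        (s + 1 - k) * (a * (s - a)) + s * (s + 1)" by (simp add: algebra_simps)
    then show "F a (s - a) = of_bool (p dvd (s + 1 - k) * (a * (s - a)) + s * (s + 1))"
      by (simp only: F_def)
  qed
  finally show ?thesis .
qed

text \<open>Solving the linear equation gives a b = -s (s + 1) / (s + 1 - k), and
  \<open>count_sum_product\<close> counts the \<open>a\<close> with that product. The two subtracted
  terms correct the sums \<open>s\<close> for which the product is 0.\<close>

lemma count_fixed_sum:
  assumes k: "\<not> p dvd k" "\<not> p dvd k - 1"
  shows "(\<Sum>a\<in>{0..<p}. of_bool (\<not> p dvd a * (s - a)) *
      of_bool (p dvd (s + 1 - k) * (a * (s - a)) + s * (s + 1))) =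
    of_bool (\<not> p dvd s + 1 - k) * (1 + Legendre (s\<^sup>2 + 4 * (s * (s + 1) * iv (s + 1 - k))) p)
    - of_bool (p dvd s - 0) - 2 * of_bool (p dvd s - (- 1))"
  (is "?count = _")
proof (cases "p dvd s + 1 - k")
  case True
  \<comment> \<open>Here s = k - 1, so the coefficient of the product vanishes while s (s + 1) = k
    (k - 1) does not: there are no solutions.\<close>
  have s: "\<not> p dvd s" "\<not> p dvd s + 1"
  proof -
    show "\<not> p dvd s"
    proof
      assume "p dvd s"
      then have "p dvd s - (s + 1 - k)" using True by (metis dvd_diff)
      then show False using k by simp
    qed
    show "\<not> p dvd s + 1"
    proof
      assume "p dvd s + 1"
      then have "p dvd (s + 1) - (s + 1 - k)" using True by (metis dvd_diff)
      then show False using k by simp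
    qed
  qed
  then have "\<not> p dvd s * (s + 1)" by (simp add: dvd_mult_iff)
  then have "\<not> p dvd (s + 1 - k) * (a * (s - a)) + s * (s + 1)" for a
    using True by (metis dvd_add_right_iff dvd_mult2)
  then have "?count = 0" by simp
  then show ?thesis using True s by simp
next
  case False
  define w where "w = iv (s + 1 - k)"
  have w: "p dvd (s + 1 - k) * w - 1" unfolding w_def by (rule dvd_mult_iv[OF False])
  have nw: "\<not> p dvd w" using False by (simp add: w_def dvd_iv_iff)
  have iff: "p dvd (s + 1 - k) * x + s * (s + 1) \<longleftrightarrow> p dvd x - (- (s * (s + 1) * w))" for x
  proof -
    have "p dvd (s + 1 - k) * x + s * (s + 1) \<longleftrightarrow> p dvd w * ((s + 1 - k) * x + s * (s + 1))"
      using nw by (simp add: dvd_mult_iff)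
    also have "w * ((s + 1 - k) * x + s * (s + 1)) = ((s + 1 - k) * w - 1) * x + (x - (- (s * (s + 1) * w)))"
      by (simp add: algebra_simps)
    also have "p dvd \<dots> \<longleftrightarrow> p dvd x - (- (s * (s + 1) * w))"
      using w by (intro dvd_add_right_iff dvd_mult2)
    finally show ?thesis .
  qed
  show ?thesis
  proof (cases "p dvd s * (s + 1)")
    case True
    then have "p dvd (s + 1 - k) * x + s * (s + 1) \<longleftrightarrow> p dvd x" for x
      using False by (simp add: dvd_mult_iff dvd_add_left_iff)
    then have count: "?count = 0" by simp
    \<comment> \<open>No pair of units has product 0, yet the symbol expression 1 + (s^2/p) equals 1
      at s = 0 and 2 at s = -1; these are the coefficients of the corrections.\<close>
    have "Legendre (s\<^sup>2 + 4 * (s * (s + 1) * w)) p = Legendre (s\<^sup>2) p"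
      using True by (intro Legendre_cong) (simp add: cong_iff_dvd_diff)
    moreover have "\<not> p dvd s + 1" if "p dvd s"
      using that by (metis dvd_add_right_iff not_dvd_numerals(1))
    moreover have "p dvd s \<or> p dvd s + 1" using True by (simp add: dvd_mult_iff)
    ultimately show ?thesis
      using False count
      by (cases "p dvd s") (simp_all add: w_def[symmetric] Legendre_dvd Legendre_square dvd_power2_iff)
  next
    case s: False
    have unit: "\<not> p dvd x \<and> p dvd x - (- (s * (s + 1) * w)) \<longleftrightarrow> p dvd x - (- (s * (s + 1) * w))" for x
    proof (intro iffI conjI notI)
      assume that: "p dvd x - (- (s * (s + 1) * w))"
      assume "p dvd x"
      then have "p dvd s * (s + 1) * w" using that by (simp add: dvd_add_right_iff)
      then show False using s nw by (simp add: dvd_mult_iff)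
    qed auto
    have "?count = (\<Sum>a\<in>{0..<p}. of_bool (p dvd a * (s - a) - (- (s * (s + 1) * w))))"
      by (simp only: iff of_bool_conj[symmetric] unit)
    also have "\<dots> = 1 + Legendre (s\<^sup>2 + 4 * (s * (s + 1) * w)) p"
      unfolding count_sum_product by simp
    finally show ?thesis
      using False s by (simp add: w_def[symmetric] dvd_mult_iff)
  qed
qed

text \<open>Summing \<open>count_fixed_sum\<close> over \<open>s\<close> costs 3 for the
  corrections. The substitution x = (k - 1) w + 1 with w = 1/(s + 1 - k) runs over units
  \<open>w\<close>, contributing p - 1 ones and missing only w = 0, that is x = 1, where the cubic
  is the nonzero square (k - 1)^2. Hence the constant (p - 1) - 1 - 3.\<close>

lemma h_generic:
  assumes k: "\<not> p dvd k" "\<not> p dvd k - 1"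
  shows "h k = p - 5 + (\<Sum>x\<in>{0..<p}. Legendre (cubic k x) p)"
proof -
  define \<psi> :: "int \<Rightarrow> int" where
    "\<psi> s = of_bool (\<not> p dvd s + 1 - k) * (1 + Legendre (s\<^sup>2 + 4 * (s * (s + 1) * iv (s + 1 - k))) p)" for s
  have \<psi>: "periodic \<psi>"
  proof (rule periodicI)
    fix x y assume xy: "[x = y] (mod p)"
    have "[x + 1 - k = y + 1 - k] (mod p)" by (intro cong_rules xy)
    then have "p dvd x + 1 - k \<longleftrightarrow> p dvd y + 1 - k" "iv (x + 1 - k) = iv (y + 1 - k)"
      by (rule cong_dvd_cong, rule iv_cong)
    moreover have "Legendre (x\<^sup>2 + 4 * (x * (x + 1) * w)) p = Legendre (y\<^sup>2 + 4 * (y * (y + 1) * w)) p" for w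
      by (intro Legendre_cong cong_rules xy)
    ultimately show "\<psi> x = \<psi> y" by (simp add: \<psi>_def)
  qed
  have "h k = (\<Sum>s\<in>{0..<p}. \<psi> s - of_bool (p dvd s - 0) - 2 * of_bool (p dvd s - (- 1)))"
    unfolding h_eq_sum_by_sum[OF k(1)] count_fixed_sum[OF k] \<psi>_def ..
  also have "\<dots> = (\<Sum>s\<in>{0..<p}. \<psi> s) - 3"
    by (simp only: sum_subtractf sum_distrib_left[symmetric] count_residue)
  also have "(\<Sum>s\<in>{0..<p}. \<psi> s) = (\<Sum>d\<in>{0..<p}. \<psi> (1 * d + (k - 1)))"
    by (rule sum_affine[OF _ \<psi>, symmetric]) simp
  also have "\<dots> = (\<Sum>d\<in>{0..<p}. of_bool (\<not> p dvd d) *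
      (1 + Legendre ((d + k - 1)\<^sup>2 + 4 * ((d + k - 1) * (d + k - 1 + 1) * iv d)) p))"
    by (simp add: \<psi>_def algebra_simps)
  also have "\<dots> = (\<Sum>d\<in>{1..p-1}.
      1 + Legendre ((d + k - 1)\<^sup>2 + 4 * ((d + k - 1) * (d + k - 1 + 1) * iv d)) p)"
    by (rule sum_units_of_bool[symmetric])
  also have "\<dots> = (\<Sum>d\<in>{1..p-1}. 1 + Legendre (cubic k ((k - 1) * iv d + 1)) p)"
  proof (intro sum.cong refl arg_cong2[where f = "(+)"])
    fix d assume "d \<in> {1..p-1}"
    then have "\<not> p dvd d" by (rule not_dvd_unit)
    then show "Legendre ((d + k - 1)\<^sup>2 + 4 * ((d + k - 1) * (d + k - 1 + 1) * iv d)) p =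
        Legendre (cubic k ((k - 1) * iv d + 1)) p"
      using k(2) by (intro Legendre_quartic_eq_cubic)
        (simp_all add: dvd_iv_iff coprime_iff cong_modular_inverse1)
  qed
  also have "\<dots> = (\<Sum>w\<in>{1..p-1}. 1 + Legendre (cubic k ((k - 1) * w + 1)) p)"
    by (rule sum_units_iv)
  also have "\<dots> = p - 1 + ((\<Sum>w\<in>{0..<p}. Legendre (cubic k ((k - 1) * w + 1)) p) - Legendre (cubic k 1) p)"
    using p_ge_5 by (simp add: sum.distrib sum_units)
  also have "(\<Sum>w\<in>{0..<p}. Legendre (cubic k ((k - 1) * w + 1)) p) = (\<Sum>x\<in>{0..<p}. Legendre (cubic k x) p)"
    by (rule sum_affine[OF k(2) periodic_Legendre_cubic])
  also have "cubic k 1 = (k - 1)\<^sup>2" by (simp add: cubic_def power2_eq_square algebra_simps)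
  also have "Legendre \<dots> p = 1" by (rule Legendre_square[OF k(2)])
  finally show ?thesis by simp
qed

text \<open>At k = 9 the cubic is nodal, equal to (2 (3x + 1))^2 x. Its symbol is that of
  \<open>x\<close> except at the node x = -1/3, where it vanishes, so only that one term of the zero
  sum \<open>sum_Legendre\<close> is lost.\<close>

lemma sum_Legendre_cubic_9: "(\<Sum>x\<in>{0..<p}. Legendre (cubic 9 x) p) = - Legendre p 3"
proof -
  \<comment> \<open>The lost symbol is written at 9x = 3 (3x), so that it depends on 3x only and the
    substitution 3x -> x evaluates it at -1.\<close>
  have "Legendre (cubic 9 x) p = Legendre x p - of_bool (p dvd 3 * x - (- 1)) * Legendre (3 * (3 * x)) p" for x
  proof -
    define z where "z = 3 * x + 1"
    have "cubic 9 x = (2 * z)\<^sup>2 * x"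
      by (simp add: z_def cubic_def power2_eq_square power3_eq_cube algebra_simps)
    moreover have "Legendre (3 * (3 * x)) p = Legendre x p"
      using Legendre_square_mult[of 3 x] by simp
    ultimately show ?thesis
      using Legendre_square_mult[of "2 * z" x]
      by (cases "p dvd z") (simp_all add: Legendre_dvd dvd_mult_iff dvd_power2_iff flip: z_def)
  qed
  then have "(\<Sum>x\<in>{0..<p}. Legendre (cubic 9 x) p) =
      - (\<Sum>x\<in>{0..<p}. of_bool (p dvd (3 * x + 0) - (- 1)) * Legendre (3 * (3 * x + 0)) p)"
    by (simp add: sum_subtractf sum_Legendre)
  also have "(\<Sum>x\<in>{0..<p}. of_bool (p dvd (3 * x + 0) - (- 1)) * Legendre (3 * (3 * x + 0)) p) =
      (\<Sum>x\<in>{0..<p}. of_bool (p dvd x - (- 1)) * Legendre (3 * x) p)"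
  proof (rule sum_affine)
    show "periodic (\<lambda>x. of_bool (p dvd x - (- 1)) * Legendre (3 * x) p)"
      by (intro periodicI arg_cong2[where f = "(*)"] arg_cong[where f = of_bool] cong_dvd_cong
          Legendre_cong cong_rules)
  qed simp
  also have "\<dots> = Legendre (3 * (- 1)) p"
    by (intro sum_residues_single periodic_Legendre cong_rules)
  finally show ?thesis by (simp add: Legendre_neg_3)
qed

lemma card_E_points: "int (card (E_points p k)) = 1 + p + (\<Sum>x\<in>{0..<p}. Legendre (cubic k x) p)"
proof -
  define A where "A x = {y \<in> {0..<p}. p dvd y\<^sup>2 - cubic k x}" for x
  have "{(x, y). x \<in> {0..<p} \<and> y \<in> {0..<p} \<and>
      [y^2 = 4 * k * x^3 + (k^2 - 6 * k - 3) * x^2 + 4 * x] (mod p)} = Sigma {0..<p} A"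
    by (auto simp: A_def cubic_def cong_iff_dvd_diff)
  then have "E_points p k = insert None (Some ` Sigma {0..<p} A)"
    by (simp only: E_points_def)
  moreover have fin: "finite (A x)" for x
    by (rule finite_subset[of _ "{0..<p}"]) (auto simp: A_def)
  ultimately have "card (E_points p k) = Suc (\<Sum>x\<in>{0..<p}. card (A x))"
    by (simp add: card_image card_SigmaI)
  moreover have "int (card (A x)) = 1 + Legendre (cubic k x) p" for x
    unfolding count_sqrt[symmetric] A_def by (simp add: Int_def)
  ultimately show ?thesis using p_ge_5 by (simp add: sum.distrib)
qed

lemma h_eq_frobenius_trace:
  assumes "\<not> p dvd k" "\<not> p dvd k - 1"
  shows "h k = p - 5 - frobenius_trace p k"
  using h_generic[OF assms] by (simp add: frobenius_trace_def card_E_points)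

lemma h_9: "h 9 = p - 5 - Legendre p 3"
proof -
  \<comment> \<open>That 9 and 9 - 1 are units is seen from their factors, since \<open>p\<close>
    may be 5 or 7.\<close>
  have "\<not> p dvd 3 * 3" "\<not> p dvd 2 * 4" by (simp_all only: dvd_mult_iff not_dvd_numerals) simp_all
  then show ?thesis using h_generic[of 9] by (simp add: sum_Legendre_cubic_9)
qed

subsection \<open>Exponential sums\<close>

abbreviation "e \<equiv> e_char p"

lemma e_add: "e (s + t) = e s * e t"
  by (simp add: e_char_def add_divide_distrib ring_distribs exp_add)

lemma e_dvd: assumes "p dvd t" shows "e t = 1"
proof -
  obtain n where "t = p * n" using assms by (auto simp: dvd_def)
  then have "e t = exp (complex_of_real (2 * real_of_int n * pi) * \<i>)"
    using p_ge_5 by (simp add: e_char_def algebra_simps)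
  then show ?thesis using exp_integer_2pi[of "real_of_int n"] by (simp add: mult_ac)
qed

lemma e_cong: assumes "[s = t] (mod p)" shows "e s = e t"
proof -
  have "e s = e (s - t) * e t" by (simp flip: e_add)
  then show ?thesis using assms by (simp add: e_dvd cong_iff_dvd_diff)
qed

lemma e_1_neq: "e 1 \<noteq> 1"
proof
  assume e1: "e 1 = 1"
  have eq: "2 * of_real pi * \<i> * of_int 1 / of_int p = complex_of_real (2 * pi / real_of_int p) * \<i>"
    by simp
  obtain n :: int where n: "2 * pi / real_of_int p = real_of_int (2 * n) * pi"
    using e1 unfolding e_char_def eq exp_eq_1 by (simp del: of_real_divide of_real_mult) blast
  have "2 * pi / real_of_int p * real_of_int p = 2 * pi" using p_ge_5 by simp
  then have "real_of_int n * real_of_int p = 1" unfolding n by simp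
  then have "real_of_int (n * p) = real_of_int 1" by simp
  then have "n * p = 1" by (simp only: of_int_eq_iff)
  then show False using not_dvd_numerals(1) by (metis dvd_triv_right)
qed

text \<open>Orthogonality: the shift u -> u + 1 multiplies the sum of all \<open>e u\<close> by
  \<open>e 1\<close>, which is not 1, so that sum is 0; for \<open>t\<close> prime to
  \<open>p\<close> scaling by \<open>t\<close> only permutes its terms.\<close>

lemma sum_e: "(\<Sum>u\<in>{0..<p}. e (u * t)) = of_int (p * of_bool (p dvd t))"
proof (cases "p dvd t")
  case True
  then show ?thesis using p_ge_5 by (simp add: e_dvd)
next
  case False
  have per: "periodic e" by (intro periodicI e_cong)
  have "(\<Sum>u\<in>{0..<p}. e u) = (\<Sum>u\<in>{0..<p}. e (1 * u + 1))"
    by (rule sum_affine[OF not_dvd_numerals(1) per, symmetric])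
  also have "\<dots> = (\<Sum>u\<in>{0..<p}. e u) * e 1" by (simp add: e_add sum_distrib_right)
  finally have "(\<Sum>u\<in>{0..<p}. e u) = 0" using e_1_neq by simp
  moreover have "(\<Sum>u\<in>{0..<p}. e (t * u + 0)) = (\<Sum>u\<in>{0..<p}. e u)"
    by (rule sum_affine[OF False per])
  ultimately show ?thesis using False by (simp add: mult.commute)
qed

lemma sum_units_e: "(\<Sum>u\<in>{1..p-1}. e (u * t)) = of_int (p * of_bool (p dvd t) - 1)"
  unfolding sum_units sum_e by (simp add: e_dvd)

text \<open>With s, t and s', t' the values of \<open>\<sigma>\<close> and \<open>\<tau>\<close> at
  two pairs, this is their contribution to the sixth moment, up to a factor \<open>p\<close>:
  orthogonality in \<open>u\<close> leaves the divisibility condition.\<close>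

definition resonance :: "int \<Rightarrow> int \<Rightarrow> int \<Rightarrow> int \<Rightarrow> complex" where
  "resonance s t s' t' = (\<Sum>z\<in>{1..p-1}. \<Sum>z'\<in>{1..p-1}.
     of_bool (p dvd iv z * t + iv z' * t') * e (z * s + z' * s'))"

text \<open>If \<open>t\<close> and \<open>t'\<close> both vanish, the sum is a product of two sums
  over units; if exactly one vanishes, the condition is never met. Otherwise z' = z w forces w =
  -t'/t, and the remaining sum over \<open>z\<close> tests s + w s' = 0, which is s t = s'
  t'.\<close>

lemma resonance_eq:
  "resonance s t s' t' = of_int (of_bool (p dvd t) * (p * of_bool (p dvd s) - 1) *
      (of_bool (p dvd t') * (p * of_bool (p dvd s') - 1)) +
    of_bool (\<not> p dvd t) * of_bool (\<not> p dvd t') * (p * of_bool (p dvd s * t - s' * t') - 1))"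
proof (cases "p dvd t"; cases "p dvd t'")
  assume t: "p dvd t" "p dvd t'"
  then have "resonance s t s' t' = (\<Sum>z\<in>{1..p-1}. e (z * s)) * (\<Sum>z'\<in>{1..p-1}. e (z' * s'))"
    unfolding resonance_def sum_product by (intro sum.cong refl) (simp add: e_add)
  then show ?thesis unfolding sum_units_e using t by simp
next
  assume t: "p dvd t" "\<not> p dvd t'"
  have "\<not> p dvd iv z * t + iv z' * t'" if "z' \<in> {1..p-1}" for z z'
    using not_dvd_unit[OF that] t by (simp add: dvd_add_right_iff dvd_mult_iff dvd_iv_iff)
  then show ?thesis using t by (simp add: resonance_def del: atLeastAtMost_iff)
next
  assume t: "\<not> p dvd t" "p dvd t'"
  have "\<not> p dvd iv z * t + iv z' * t'" if "z \<in> {1..p-1}" for z z'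
    using not_dvd_unit[OF that] t by (simp add: dvd_add_left_iff dvd_mult_iff dvd_iv_iff)
  then show ?thesis using t by (simp add: resonance_def del: atLeastAtMost_iff)
next
  assume t: "\<not> p dvd t" "\<not> p dvd t'"
  define w0 where "w0 = - (iv t * t')"
  have tw: "p dvd t * w + t' \<longleftrightarrow> p dvd w - w0" for w
  proof -
    have "p dvd t * w + t' \<longleftrightarrow> p dvd iv t * (t * w + t')"
      using t by (simp add: dvd_mult_iff dvd_iv_iff)
    also have "iv t * (t * w + t') = (t * iv t - 1) * w + (w - w0)"
      by (simp add: w0_def algebra_simps)
    also have "p dvd \<dots> \<longleftrightarrow> p dvd w - w0"
      using dvd_mult_iv[OF t(1)] by (intro dvd_add_right_iff dvd_mult2)
    finally show ?thesis .
  qed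
  have "resonance s t s' t' = (\<Sum>z\<in>{1..p-1}. \<Sum>w\<in>{1..p-1}.
      of_bool (p dvd w - w0) * e (z * (s + w * s')))"
    unfolding resonance_def
  proof (rule sum.cong[OF refl])
    fix z assume z: "z \<in> {1..p-1}"
    have per: "periodic (\<lambda>z'. of_bool (p dvd iv z * t + iv z' * t') * e (z * s + z' * s'))"
    proof (rule periodicI)
      fix x y assume xy: "[x = y] (mod p)"
      have "e (z * s + x * s') = e (z * s + y * s')" by (intro e_cong cong_rules xy)
      then show "of_bool (p dvd iv z * t + iv x * t') * e (z * s + x * s') =
          of_bool (p dvd iv z * t + iv y * t') * e (z * s + y * s')"
        using iv_cong[OF xy] by simp
    qed
    have "(\<Sum>z'\<in>{1..p-1}. of_bool (p dvd iv z * t + iv z' * t') * e (z * s + z' * s')) =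
        (\<Sum>w\<in>{1..p-1}. of_bool (p dvd iv z * t + iv (z * w) * t') * e (z * s + (z * w) * s'))"
      by (rule sum_units_mult[OF not_dvd_unit[OF z] per, symmetric])
    also have "\<dots> = (\<Sum>w\<in>{1..p-1}. of_bool (p dvd w - w0) * e (z * (s + w * s')))"
    proof (rule sum.cong[OF refl])
      fix w assume w: "w \<in> {1..p-1}"
      have "p dvd iv z * t + iv (z * w) * t' \<longleftrightarrow> p dvd iv z * t + (iv z * iv w) * t'"
        by (intro cong_dvd_cong cong_rules iv_mult)
      also have "\<dots> \<longleftrightarrow> p dvd w * (iv z * t + (iv z * iv w) * t')"
        using not_dvd_unit[OF w] by (simp add: dvd_mult_iff)
      also have "w * (iv z * t + (iv z * iv w) * t') = (w * iv w - 1) * (iv z * t') + iv z * (t * w + t')"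
        by (simp add: algebra_simps)
      also have "p dvd \<dots> \<longleftrightarrow> p dvd iv z * (t * w + t')"
        using dvd_mult_iv[OF not_dvd_unit[OF w]] by (intro dvd_add_right_iff dvd_mult2)
      also have "\<dots> \<longleftrightarrow> p dvd w - w0"
        using not_dvd_unit[OF z] tw by (simp add: dvd_mult_iff dvd_iv_iff)
      finally show "of_bool (p dvd iv z * t + iv (z * w) * t') * e (z * s + (z * w) * s') =
          of_bool (p dvd w - w0) * e (z * (s + w * s'))"
        by (simp add: algebra_simps)
    qed
    finally show "(\<Sum>z'\<in>{1..p-1}. of_bool (p dvd iv z * t + iv z' * t') * e (z * s + z' * s')) =
        (\<Sum>w\<in>{1..p-1}. of_bool (p dvd w - w0) * e (z * (s + w * s')))" .
  qed
  also have "\<dots> = (\<Sum>w\<in>{1..p-1}. \<Sum>z\<in>{1..p-1}. of_bool (p dvd w - w0) * e (z * (s + w * s')))"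
    by (rule sum.swap)
  also have "\<dots> = (\<Sum>w\<in>{1..p-1}. of_bool (p dvd w - w0) * of_int (p * of_bool (p dvd s + w * s') - 1))"
    by (simp only: sum_distrib_left[symmetric] sum_units_e)
  \<comment> \<open>The term at w = 0 may be added because \<open>w0\<close> is a unit, so the
    indicator is 0 there.\<close>
  also have "\<dots> = (\<Sum>w\<in>{0..<p}. of_bool (p dvd w - w0) * of_int (p * of_bool (p dvd s + w * s') - 1))"
    using tw[of 0] t by (simp only: sum_residues_split) simp
  also have "\<dots> = of_int (p * of_bool (p dvd s + w0 * s') - 1)"
  proof (rule sum_residues_single, rule periodicI)
    fix x y assume xy: "[x = y] (mod p)"
    have "p dvd s + x * s' \<longleftrightarrow> p dvd s + y * s'" by (intro cong_dvd_cong cong_rules xy)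
    then show "of_int (p * of_bool (p dvd s + x * s') - 1) = (of_int (p * of_bool (p dvd s + y * s') - 1) :: complex)"
      by simp
  qed
  also have "p dvd s + w0 * s' \<longleftrightarrow> p dvd s * t - s' * t'"
  proof -
    have "p dvd s + w0 * s' \<longleftrightarrow> p dvd t * (s + w0 * s')"
      using t by (simp add: dvd_mult_iff)
    also have "t * (s + w0 * s') = (s * t - s' * t') - (t * iv t - 1) * (t' * s')"
      by (simp add: w0_def algebra_simps)
    also have "p dvd \<dots> \<longleftrightarrow> p dvd s * t - s' * t'"
      using dvd_mult_iv[OF t(1)] by (intro dvd_diff_left_iff dvd_mult2)
    finally show ?thesis .
  qed
  finally show ?thesis using t by simp
qed

section \<open>The sixth moment in terms of \<open>h\<close>\<close>

abbreviation pairs :: "(int \<times> int) set" where "pairs \<equiv> {1..p-1} \<times> {1..p-1}"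

lemma kloosterman_cubed:
  "kloosterman p u ^ 3 = (\<Sum>((a, b), z)\<in>pairs \<times> {1..p-1}. e (z * \<sigma> a b + u * (iv z * \<tau> a b)))"
proof -
  \<comment> \<open>Since x -> z x permutes the units, two of the three factors can be rescaled by
    the variable \<open>z\<close> of the remaining one.\<close>
  have K: "kloosterman p u = (\<Sum>x\<in>{1..p-1}. e (z * x + u * (iv z * iv x)))" if "z \<in> {1..p-1}" for z
  proof -
    have "periodic (\<lambda>x. e (x + u * iv x))"
      by (rule periodicI) (metis cong_add cong_refl iv_cong e_cong)
    then have "kloosterman p u = (\<Sum>x\<in>{1..p-1}. e (z * x + u * iv (z * x)))"
      unfolding kloosterman_def by (rule sum_units_mult[OF not_dvd_unit[OF that], symmetric])
    also have "\<dots> = (\<Sum>x\<in>{1..p-1}. e (z * x + u * (iv z * iv x)))"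
      by (intro sum.cong refl e_cong cong_rules iv_mult)
    finally show ?thesis .
  qed
  have "kloosterman p u ^ 3 = (\<Sum>z\<in>{1..p-1}. e (z + u * iv z) * kloosterman p u * kloosterman p u)"
    by (simp add: kloosterman_def power3_eq_cube sum_distrib_right)
  also have "\<dots> = (\<Sum>z\<in>{1..p-1}. e (z + u * iv z) *
      (\<Sum>a\<in>{1..p-1}. e (z * a + u * (iv z * iv a))) * (\<Sum>b\<in>{1..p-1}. e (z * b + u * (iv z * iv b))))"
    by (intro sum.cong refl arg_cong2[where f = "(*)"] K)
  also have "\<dots> = (\<Sum>z\<in>{1..p-1}. \<Sum>a\<in>{1..p-1}. \<Sum>b\<in>{1..p-1}. e (z + u * iv z) *
      e (z * a + u * (iv z * iv a)) * e (z * b + u * (iv z * iv b)))"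
    by (simp only: mult.assoc sum_product) (simp only: sum_distrib_left)
  also have "\<dots> = (\<Sum>z\<in>{1..p-1}. \<Sum>a\<in>{1..p-1}. \<Sum>b\<in>{1..p-1}. e (z * \<sigma> a b + u * (iv z * \<tau> a b)))"
    by (simp only: e_add[symmetric]) (simp add: \<sigma>_def \<tau>_def algebra_simps)
  also have "\<dots> = (\<Sum>z\<in>{1..p-1}. \<Sum>(a, b)\<in>pairs. e (z * \<sigma> a b + u * (iv z * \<tau> a b)))"
    by (simp only: sum.cartesian_product)
  also have "\<dots> = (\<Sum>P\<in>pairs. \<Sum>z\<in>{1..p-1}. case P of (a, b) \<Rightarrow> e (z * \<sigma> a b + u * (iv z * \<tau> a b)))"
    by (rule sum.swap)
  finally show ?thesis by (simp add: sum.cartesian_product split_def)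
qed

text \<open>The sixth power is the square of the cube, and summing over all \<open>u\<close>,
  including 0, makes orthogonality exact.\<close>

lemma sum_kloosterman_sixth:
  "(\<Sum>u\<in>{0..<p}. kloosterman p u ^ 6) = of_int p * (\<Sum>(a, b)\<in>pairs. \<Sum>(c, d)\<in>pairs.
    resonance (\<sigma> a b) (\<tau> a b) (\<sigma> c d) (\<tau> c d))"
proof -
  define T where "T = pairs \<times> {1..p-1}"
  define A where "A = (\<lambda>((a, b), z). z * \<sigma> a b)"
  define B where "B = (\<lambda>((a, b), z). iv z * \<tau> a b)"
  have T: "(\<Sum>t\<in>T. f t) = (\<Sum>P\<in>pairs. \<Sum>z\<in>{1..p-1}. f (P, z))" for f :: "_ \<Rightarrow> complex"
    by (simp add: T_def sum.cartesian_product)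
  have K3: "kloosterman p u ^ 3 = (\<Sum>t\<in>T. e (A t + u * B t))" for u
    unfolding kloosterman_cubed T_def by (intro sum.cong refl) (simp add: A_def B_def split_def)
  have K6: "kloosterman p u ^ 6 = (\<Sum>t\<in>T. \<Sum>t'\<in>T. e (A t + A t') * e (u * (B t + B t')))" for u
  proof -
    have "kloosterman p u ^ 6 = kloosterman p u ^ 3 * kloosterman p u ^ 3"
      by (simp flip: power_add)
    also have "\<dots> = (\<Sum>t\<in>T. \<Sum>t'\<in>T. e (A t + u * B t) * e (A t' + u * B t'))"
      by (simp only: K3 sum_product)
    finally show ?thesis
      by (simp only: e_add[symmetric]) (simp add: algebra_simps)
  qed
  have "(\<Sum>u\<in>{0..<p}. kloosterman p u ^ 6) =
      (\<Sum>t\<in>T. \<Sum>u\<in>{0..<p}. \<Sum>t'\<in>T. e (A t + A t') * e (u * (B t + B t')))"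
    unfolding K6 by (rule sum.swap)
  also have "\<dots> = (\<Sum>t\<in>T. \<Sum>t'\<in>T. \<Sum>u\<in>{0..<p}. e (A t + A t') * e (u * (B t + B t')))"
    by (intro sum.cong[OF refl] sum.swap)
  also have "\<dots> = of_int p * (\<Sum>t\<in>T. \<Sum>t'\<in>T. of_bool (p dvd B t + B t') * e (A t + A t'))"
    unfolding sum_distrib_left[symmetric] sum_e by (simp add: sum_distrib_left mult_ac)
  also have "(\<Sum>t\<in>T. \<Sum>t'\<in>T. of_bool (p dvd B t + B t') * e (A t + A t')) =
      (\<Sum>P\<in>pairs. \<Sum>z\<in>{1..p-1}. \<Sum>P'\<in>pairs. \<Sum>z'\<in>{1..p-1}.
        of_bool (p dvd B (P, z) + B (P', z')) * e (A (P, z) + A (P', z')))"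
    by (simp only: T)
  also have "\<dots> = (\<Sum>P\<in>pairs. \<Sum>P'\<in>pairs. \<Sum>z\<in>{1..p-1}. \<Sum>z'\<in>{1..p-1}.
        of_bool (p dvd B (P, z) + B (P', z')) * e (A (P, z) + A (P', z')))"
    by (intro sum.cong[OF refl] sum.swap)
  also have "\<dots> = (\<Sum>P\<in>pairs. \<Sum>P'\<in>pairs. case P of (a, b) \<Rightarrow> case P' of (c, d) \<Rightarrow>
        resonance (\<sigma> a b) (\<tau> a b) (\<sigma> c d) (\<tau> c d))"
    by (intro sum.cong refl) (simp add: A_def B_def resonance_def split_def)
  finally show ?thesis by (simp add: split_def)
qed

text \<open>Since \<open>h k\<close> is the size of a fibre of \<open>\<sigma> \<tau>\<close>, the
  sum of squares counts coincidences between two pairs.\<close>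

lemma sum_h_squared:
  "(\<Sum>k\<in>{0..<p}. (h k)\<^sup>2) = (\<Sum>(a, b)\<in>pairs. \<Sum>(c, d)\<in>pairs. of_bool (\<not> p dvd \<tau> a b) *
    of_bool (\<not> p dvd \<tau> c d) * of_bool (p dvd \<sigma> a b * \<tau> a b - \<sigma> c d * \<tau> c d))"
proof -
  define Y :: "int \<times> int \<Rightarrow> int" where "Y = (\<lambda>(a, b). of_bool (\<not> p dvd \<tau> a b))"
  define g where "g = (\<lambda>(a, b). \<sigma> a b * \<tau> a b)"
  have h: "h k = (\<Sum>P\<in>pairs. Y P * of_bool (p dvd g P - k))" for k
    unfolding h_def sum.cartesian_product by (simp add: Y_def g_def split_def of_bool_conj)
  have "(\<Sum>k\<in>{0..<p}. (h k)\<^sup>2) = (\<Sum>k\<in>{0..<p}. \<Sum>P\<in>pairs. \<Sum>P'\<in>pairs.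
      (Y P * of_bool (p dvd g P - k)) * (Y P' * of_bool (p dvd g P' - k)))"
    by (simp only: h power2_eq_square sum_product)
  also have "\<dots> = (\<Sum>P\<in>pairs. \<Sum>k\<in>{0..<p}. \<Sum>P'\<in>pairs.
      (Y P * of_bool (p dvd g P - k)) * (Y P' * of_bool (p dvd g P' - k)))"
    by (rule sum.swap)
  also have "\<dots> = (\<Sum>P\<in>pairs. \<Sum>P'\<in>pairs. \<Sum>k\<in>{0..<p}.
      (Y P * of_bool (p dvd g P - k)) * (Y P' * of_bool (p dvd g P' - k)))"
    by (intro sum.cong[OF refl] sum.swap)
  also have "\<dots> = (\<Sum>P\<in>pairs. \<Sum>P'\<in>pairs. Y P * Y P' * of_bool (p dvd g P - g P'))"
  proof (rule sum.cong[OF refl], rule sum.cong[OF refl])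
    fix P P'
    have "(\<Sum>k\<in>{0..<p}. (Y P * of_bool (p dvd g P - k)) * (Y P' * of_bool (p dvd g P' - k))) =
        Y P * Y P' * (\<Sum>k\<in>{0..<p}. of_bool (p dvd k - g P') * of_bool (p dvd g P - k))"
      unfolding sum_distrib_left by (intro sum.cong refl) (auto simp: dvd_diff_commute)
    also have "(\<Sum>k\<in>{0..<p}. of_bool (p dvd k - g P') * of_bool (p dvd g P - k)) = (of_bool (p dvd g P - g P') :: int)"
      by (intro sum_residues_single periodic_of_bool cong_rules)
    finally show "(\<Sum>k\<in>{0..<p}. (Y P * of_bool (p dvd g P - k)) * (Y P' * of_bool (p dvd g P' - k))) =
        Y P * Y P' * of_bool (p dvd g P - g P')" .
  qed
  finally show ?thesis by (simp add: Y_def g_def split_def)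
qed

text \<open>The double sum of \<open>resonance_eq\<close> separates: pairs with vanishing
  \<open>\<tau>\<close> give the square of p (1 + L) - (p - 2), where L = (p/3), while the others
  give \<open>p\<close> times the coincidence count minus the square of their number.\<close>

lemma sixth_moment_h:
  "(\<Sum>u\<in>{0..<p}. kloosterman p u ^ 6) =
    of_int (p * ((p * Legendre p 3 + 2)\<^sup>2 + p * (\<Sum>k\<in>{0..<p}. (h k)\<^sup>2) - (p\<^sup>2 - 3 * p + 3)\<^sup>2))"
proof -
  define X :: "int \<times> int \<Rightarrow> int" where
    "X = (\<lambda>(a, b). of_bool (p dvd \<tau> a b) * (p * of_bool (p dvd \<sigma> a b) - 1))"
  define Y :: "int \<times> int \<Rightarrow> int" where "Y = (\<lambda>(a, b). of_bool (\<not> p dvd \<tau> a b))"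
  define g where "g = (\<lambda>(a, b). \<sigma> a b * \<tau> a b)"
  have "(\<Sum>P\<in>pairs. X P) = (\<Sum>a\<in>{1..p-1}. \<Sum>b\<in>{1..p-1}.
      p * of_bool (p dvd \<sigma> a b \<and> p dvd \<tau> a b) - of_bool (p dvd \<tau> a b))"
    unfolding X_def sum.cartesian_product[symmetric] by (intro sum.cong refl) auto
  also have "\<dots> = p * Legendre p 3 + 2"
    by (simp only: sum_subtractf sum_distrib_left[symmetric] count_sigma_tau count_tau) (simp add: algebra_simps)
  finally have X: "(\<Sum>P\<in>pairs. X P) = p * Legendre p 3 + 2" .
  have Y: "(\<Sum>P\<in>pairs. Y P) = p\<^sup>2 - 3 * p + 3"
    unfolding Y_def sum.cartesian_product[symmetric] by (rule count_tau_nonzero)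
  have Z: "(\<Sum>P\<in>pairs. \<Sum>P'\<in>pairs. Y P * Y P' * of_bool (p dvd g P - g P')) = (\<Sum>k\<in>{0..<p}. (h k)\<^sup>2)"
    unfolding sum_h_squared Y_def g_def by (simp add: split_def)
  have "(\<Sum>(a, b)\<in>pairs. \<Sum>(c, d)\<in>pairs. resonance (\<sigma> a b) (\<tau> a b) (\<sigma> c d) (\<tau> c d)) =
      of_int (\<Sum>P\<in>pairs. \<Sum>P'\<in>pairs. X P * X P' + Y P * Y P' * (p * of_bool (p dvd g P - g P') - 1))"
    unfolding resonance_eq by (simp add: X_def Y_def g_def split_def)
  also have "(\<Sum>P\<in>pairs. \<Sum>P'\<in>pairs. X P * X P' + Y P * Y P' * (p * of_bool (p dvd g P - g P') - 1)) =
      (\<Sum>P\<in>pairs. \<Sum>P'\<in>pairs. X P * X P' + p * (Y P * Y P' * of_bool (p dvd g P - g P')) - Y P * Y P')"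
    by (intro sum.cong refl) (simp add: algebra_simps)
  also have "\<dots> = (\<Sum>P\<in>pairs. X P)\<^sup>2 +
      p * (\<Sum>P\<in>pairs. \<Sum>P'\<in>pairs. Y P * Y P' * of_bool (p dvd g P - g P')) - (\<Sum>P\<in>pairs. Y P)\<^sup>2"
    unfolding power2_eq_square sum_product
    by (simp only: sum.distrib sum_subtractf sum_distrib_left[of p])
  finally show ?thesis unfolding sum_kloosterman_sixth X Y Z by simp
qed

text \<open>The term u = 0, present in the full moment but not in \<open>V6\<close>, is (-1)^6 =
  1.\<close>

lemma V6_h:
  "V6 p = of_int (p * ((p * Legendre p 3 + 2)\<^sup>2 + p * (\<Sum>k\<in>{0..<p}. (h k)\<^sup>2) - (p\<^sup>2 - 3 * p + 3)\<^sup>2) - 1)"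
proof -
  have "kloosterman p 0 = - 1"
    using sum_units_e[of 1] by (simp add: kloosterman_def)
  then show ?thesis
    unfolding V6_def sum_units sixth_moment_h by simp
qed

section \<open>Summation over the parameters \<open>k\<close>\<close>

lemma sum_residues_parameters:
  fixes f :: "int \<Rightarrow> int"
  assumes "periodic f"
  shows "(\<Sum>k\<in>{0..<p}. f k) = f 0 + f 1 + f 9 + (\<Sum>k | k \<in> {2..p-1} \<and> \<not> [k = 9] (mod p). f k)"
proof -
  define q where "q = 9 mod p"
  \<comment> \<open>Since 9 and 8 are units, the class of 9 differs from those of 0 and 1, so its
    representative \<open>q\<close> lies in \<open>{2..p-1}\<close> even when \<open>p\<close> is 5
    or 7.\<close>
  have "\<not> p dvd 3 * 3" "\<not> p dvd 2 * 4" by (simp_all only: dvd_mult_iff not_dvd_numerals) simp_all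
  then have "q \<noteq> 0" "q \<noteq> 1"
    unfolding q_def using mod_eq_dvd_iff[of 9 p 1] p_ge_5 by (auto simp: dvd_eq_mod_eq_0)
  moreover have "0 \<le> q" "q < p" using p_ge_5 by (simp_all add: q_def)
  ultimately have q: "q \<in> {2..p-1}" by auto
  have "{k. k \<in> {2..p-1} \<and> \<not> [k = 9] (mod p)} = {2..p-1} - {q}"
    by (auto simp: cong_def q_def)
  moreover have "(\<Sum>k\<in>{2..p-1}. f k) = f q + (\<Sum>k\<in>{2..p-1} - {q}. f k)"
    using q by (intro sum.remove) auto
  moreover have "f q = f 9" unfolding q_def by (rule periodic_mod[OF assms])
  moreover have "{0..<p} = insert 0 (insert 1 {2..p-1})" using p_ge_5 by auto
  ultimately show ?thesis by simp
qed

lemma periodic_h: "periodic h"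
proof (rule periodicI)
  fix x y assume xy: "[x = y] (mod p)"
  have "p dvd t - x \<longleftrightarrow> p dvd t - y" for t by (intro cong_dvd_cong cong_rules xy)
  then show "h x = h y" by (simp add: h_def)
qed

text \<open>For admissible \<open>k\<close> one has a_p(E_k) + 1 = p - 4 - h k. Expanding its square
  reduces the sum over curves to the moments of \<open>h\<close> of order 0, 1 and 2, each being a
  full moment less the values at 0, 1 and 9.\<close>

theorem V6_eq:
  "V6 p = of_int (4 * p^4 - 8 * p^3 + (4 * Legendre p 3 + 2) * p^2 - 5 * p - 1
     + p^2 * (\<Sum>k | k \<in> {2..p-1} \<and> \<not> [k = 9] (mod p). (frobenius_trace p k + 1)^2))"
proof -
  define L where "L = Legendre p 3"
  define N where "N = {k. k \<in> {2..p-1} \<and> \<not> [k = 9] (mod p)}"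
  have "finite N" by (rule finite_subset[of _ "{2..p-1}"]) (auto simp: N_def)
  \<comment> \<open>The equal symbol (-3/p) is nonzero because \<open>p\<close> does not divide
    3.\<close>
  have "L\<^sup>2 = 1"
    using not_dvd_numerals prime_p p_ge_5 unfolding L_def Legendre_neg_3[symmetric]
    by (simp add: Legendre_def cong_0_iff)
  have ones: "(\<Sum>k\<in>{0..<p}. 1) = 1 + 1 + 1 + (\<Sum>k\<in>N. 1::int)"
    unfolding N_def by (rule sum_residues_parameters) (simp add: periodic_def)
  have lin: "p\<^sup>2 - 3 * p + 3 = h 0 + h 1 + h 9 + (\<Sum>k\<in>N. h k)"
    unfolding N_def sum_h[symmetric] by (rule sum_residues_parameters[OF periodic_h])
  have sq: "(\<Sum>k\<in>{0..<p}. (h k)\<^sup>2) = (h 0)\<^sup>2 + (h 1)\<^sup>2 + (h 9)\<^sup>2 + (\<Sum>k\<in>N. (h k)\<^sup>2)"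
    unfolding N_def by (rule sum_residues_parameters) (rule periodicI, simp only: periodicD[OF periodic_h])
  have "(\<Sum>k\<in>N. (frobenius_trace p k + 1)\<^sup>2) =
      (\<Sum>k\<in>N. (p - 4)\<^sup>2 * 1 - 2 * (p - 4) * h k + (h k)\<^sup>2)"
  proof (rule sum.cong[OF refl])
    fix k assume "k \<in> N"
    then have "\<not> p dvd k" "\<not> p dvd k - 1"
      using not_dvd_small[of k] not_dvd_small[of "k - 1"] by (auto simp: N_def)
    then have trace: "frobenius_trace p k = p - 5 - h k" using h_eq_frobenius_trace by simp
    show "(frobenius_trace p k + 1)\<^sup>2 = (p - 4)\<^sup>2 * 1 - 2 * (p - 4) * h k + (h k)\<^sup>2"
      unfolding trace by (simp add: power2_eq_square algebra_simps)
  qed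
  also have "\<dots> = (p - 4)\<^sup>2 * (\<Sum>k\<in>N. 1) - 2 * (p - 4) * (\<Sum>k\<in>N. h k) + (\<Sum>k\<in>N. (h k)\<^sup>2)"
    by (simp only: sum.distrib sum_subtractf sum_distrib_left[symmetric])
  also have "(\<Sum>k\<in>N. 1) = p - 3" using ones p_ge_5 by simp
  also have "(\<Sum>k\<in>N. h k) = p\<^sup>2 - 8 * p + 17 + 2 * L"
    using lin by (simp add: h_0 h_1 h_9 L_def)
  also have "(\<Sum>k\<in>N. (h k)\<^sup>2) = (\<Sum>k\<in>{0..<p}. (h k)\<^sup>2) - (p - 3 - L)\<^sup>2 - (3 * p - 6)\<^sup>2 - (p - 5 - L)\<^sup>2"
    using sq by (simp add: h_0 h_1 h_9 L_def)
  finally have S: "(\<Sum>k\<in>{0..<p}. (h k)\<^sup>2) = (\<Sum>k\<in>N. (frobenius_trace p k + 1)\<^sup>2)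
      - (p - 4)\<^sup>2 * (p - 3) + 2 * (p - 4) * (p\<^sup>2 - 8 * p + 17 + 2 * L)
      + (p - 3 - L)\<^sup>2 + (3 * p - 6)\<^sup>2 + (p - 5 - L)\<^sup>2" by simp
  \<comment> \<open>A polynomial identity in which \<open>L\<close> is treated as an indeterminate;
    the last summand collects the multiple of L^2 - 1, which vanishes.\<close>
  have "p * ((p * L + 2)\<^sup>2 + p * (\<Sum>k\<in>{0..<p}. (h k)\<^sup>2) - (p\<^sup>2 - 3 * p + 3)\<^sup>2) - 1 =
      4 * p^4 - 8 * p^3 + (4 * L + 2) * p^2 - 5 * p - 1
      + p^2 * (\<Sum>k\<in>N. (frobenius_trace p k + 1)^2) + (L\<^sup>2 - 1) * (p^3 + 2 * p^2)"
    unfolding S by (simp add: power2_eq_square power3_eq_cube power4_eq_xxxx algebra_simps)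
  then show ?thesis unfolding V6_h using \<open>L\<^sup>2 = 1\<close> by (simp add: L_def N_def)
qed

end

theorem theorem1:
  fixes p :: int
  assumes "prime p" and "p \<ge> 5"
  shows "V6 p = of_int (4 * p^4 - 8 * p^3 + (4 * Legendre p 3 + 2) * p^2 - 5 * p - 1
           + p^2 * (\<Sum>k | k \<in> {2..p-1} \<and> \<not> [k = 9] (mod p). (frobenius_trace p k + 1)^2))"
proof -
  interpret prime_modulus p by standard fact+
  show ?thesis by (rule V6_eq)
qed

end
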